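(* Let $p\ge 1$, let $\mathcal{G}\subseteq 2^{\{1,\ldots,p\}}$ be a set of groups of variables (arbitrarily overlapping), let $(\eta_g)_{g\in\mathcal{G}}$ be positive weights, let $\lambda>0$ and let $\mathbf{u}\in\mathbb{R}^p$. Then Algorithm 1 (defined in the context), run on the input $(\mathbf{u},\mathcal{G},(\eta_g)_{g\in\mathcal{G}},\lambda)$, terminates after a finite number of operations which is polynomial (in $p$ and $|\mathcal{G}|$).
   Context: Groups in $\mathcal{G}$ are nonempty subsets of $\{1,\ldots,p\}$. Operations are elementary arithmetic operations and comparisons on real numbers; the max-flow steps below are carried out by a (strongly) polynomial-time max-flow algorithm, and the projection steps by a polynomial-time projection algorithm. Sign convention: one may assume $\mathbf{u}_j\ge 0$ for all $j$; for a general $\mathbf{u}$ the algorithm is run on $(|\mathbf{u}_j|)_j$ and the signs of the $\mathbf{u}_j$ are restored in the output. Flows: on a directed graph with source $s$, sink $t$ and non-negative arc capacities, a flow is a non-negative function on arcs, bounded by the capacity on each arc, such that incoming and outgoing flow are equal at every vertex other than $s,t$. Canonical graph: $G=(V,E,s,t)$ with $V=V_u\cup V_{gr}$, where $V_u=\{1,\ldots,p\}$ (one vertex per variable) and $V_{gr}=\mathcal{G}$ (one vertex per group), and whose arcs are: $(s,g)$ for every $g\in\mathcal{G}$, with capacity $\lambda\eta_g$ and zero cost; $(g,j)$ for every $g\in\mathcal{G}$ and $j\in g$, with infinite capacity and zero cost; $(j,t)$ for every $j\in\{1,\ldots,p\}$, with infinite capacity and cost $\frac12(\mathbf{u}_j-\overline{\boldsymbol\xi}_j)^2$,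 where $\overline{\boldsymbol\xi}_j$ denotes the flow on $(j,t)$. Algorithm 1: build the canonical graph $G_0=(V_0,E_0,s,t)$, compute $\overline{\boldsymbol\xi}\leftarrow\texttt{computeFlow}(V_0,E_0)$, and return $\mathbf{w}=\mathbf{u}-\overline{\boldsymbol\xi}$. The recursive function $\texttt{computeFlow}(V=V_u\cup V_{gr},E)$ is: (1) Projection step: let $\boldsymbol\gamma=(\boldsymbol\gamma_j)_{j\in V_u}$ be the minimizer of $\sum_{j\in V_u}\frac12(\mathbf{u}_j-\boldsymbol\gamma_j)^2$ subject to $\boldsymbol\gamma_j\ge 0$ for all $j \in V_u$ and $\sum_{j\in V_u}\boldsymbol\gamma_j\le\lambda\sum_{g\in V_{gr}}\eta_g$. (2) For all $j\in V_u$, set the capacity of the arc $(j,t)$ to $\boldsymbol\gamma_j$. (3) Max-flow step: compute a maximum flow from $s$ to $t$ on $(V,E,s,t)$, and let $\overline{\boldsymbol\xi}_j$ be its value on $(j,t)$, $j\in V_u$. (4) If there exists $j\in V_u$ with $\overline{\boldsymbol\xi}_j\ne\boldsymbol\gamma_j$: let $(s,V^+)$ and $(V^-,t)$ be the two disjoint parts of $V \cup\{s,t\}$ separated by the minimum $(s,t)$-cut, where $V^+$ is the set of vertices of $V$ reachable from $s$ by a non-saturated path (a path in the residual graph of the max-flow) and $V^-=V\setminus V^+$; remove all arcs between $V^+$ and $V^-$, and let $E^+$, $E^-$ be the remaining arcs corresponding to $V^+$ and $V^-$ (including the arcs to/from $s,t$); replace $(\overline{\boldsymbol\xi}_j)_{j\in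 V_u\cap V^+}$ by $\texttt{computeFlow}(V^+,E^+)$ and $(\overline{\boldsymbol\xi}_j)_{j\in V_u\cap V^-}$ by $\texttt{computeFlow}(V^-,E^-)$. (5) Return $(\overline{\boldsymbol\xi}_j)_{j\in V_u}$. *)

theory Defs
  imports
    "HOL-Library.Extended_Real"
    "HOL-Computational_Algebra.Polynomial"
begin

section \<open>Computations with an operation count\<close>

text \<open>
  \<open>Some (x, n)\<close> is a computation that terminates with result \<open>x\<close> after \<open>n\<close> operations;
  \<open>None\<close> is a computation that does not terminate.
\<close>

type_synonym 'a comp = "('a \<times> nat) option"

definition charge :: "nat \<Rightarrow> 'a \<Rightarrow> 'a comp" where
  "charge n x = Some (x, n)"

definition ret :: "'a \<Rightarrow> 'a comp" where
  "ret x = charge 0 x"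

definition bind_comp :: "'a comp \<Rightarrow> ('a \<Rightarrow> 'b comp) \<Rightarrow> 'b comp" (infixr "\<rhd>" 54) where
  "m \<rhd> f = Option.bind m (\<lambda>r. Option.bind (f (fst r)) (\<lambda>q. Some (fst q, snd r + snd q)))"

lemma bind_comp_mono [partial_function_mono]:
  assumes "mono_option B" and "\<And>y. mono_option (\<lambda>f. C y f)"
  shows "mono_option (\<lambda>f. B f \<rhd> (\<lambda>y. C y f))"
  unfolding bind_comp_def
  by (intro bind_mono assms option.const_mono)

definition sub_op :: "real \<Rightarrow> real \<Rightarrow> real comp" where
  "sub_op x y = charge 1 (x - y)"

definition mult_op :: "real \<Rightarrow> real \<Rightarrow> real comp" where
  "mult_op x y = charge 1 (x * y)"

definition eq_op :: "real \<Rightarrow> real \<Rightarrow> bool comp" where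
  "eq_op x y = charge 1 (x = y)"

text \<open>The type is \<^typ>\<open>ereal\<close> because capacities may be infinite.\<close>

definition less_op :: "ereal \<Rightarrow> ereal \<Rightarrow> bool comp" where
  "less_op x y = charge 1 (x < y)"

text \<open>
  Loop over a finite set: it terminates iff all its passes do, its result tabulates the
  results of the passes, and the operations of all passes are added up.
\<close>

definition for_each :: "'a set \<Rightarrow> ('a \<Rightarrow> 'b comp) \<Rightarrow> ('a \<Rightarrow> 'b) comp" where
  "for_each A F =
     (if \<forall>x\<in>A. F x \<noteq> None
      then Some (\<lambda>x. if x \<in> A then fst (the (F x)) else undefined, \<Sum>x\<in>A. snd (the (F x)))
      else None)"

text \<open>Summation of the entries of a table: one addition per entry.\<close>

definition sum_ops :: "'a set \<Rightarrow> ('a \<Rightarrow> real) \<Rightarrow> real comp" where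
  "sum_ops A x = charge (card A) (sum x A)"

text \<open>Polynomials in two variables with natural coefficients, for bounds on operation counts.\<close>

definition eval2 :: "nat poly poly \<Rightarrow> nat \<Rightarrow> nat \<Rightarrow> nat" where
  "eval2 P x y = poly (poly P [:x:]) y"


section \<open>Networks and maximum flows\<close>

text \<open>
  As in the notation \<open>(V, E, s, t)\<close>, the set \<open>verts\<close> does not contain the source and the sink.
  The cost of an arc is a function of the flow on it.
\<close>

record 'v network =
  verts :: "'v set"
  arcs :: "('v \<times> 'v) set"
  source :: 'v
  sink :: 'v
  capacity :: "'v \<times> 'v \<Rightarrow> ereal"
  cost :: "'v \<times> 'v \<Rightarrow> real \<Rightarrow> real"

definition wf_network :: "'v network \<Rightarrow> bool" where
  "wf_network N \<longleftrightarrow>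
     finite (verts N) \<and>
     source N \<noteq> sink N \<and> source N \<notin> verts N \<and> sink N \<notin> verts N \<and>
     arcs N \<subseteq> (verts N \<union> {source N, sink N}) \<times> (verts N \<union> {source N, sink N}) \<and>
     (\<forall>e\<in>arcs N. 0 \<le> capacity N e)"

definition inflow :: "'v network \<Rightarrow> ('v \<times> 'v \<Rightarrow> real) \<Rightarrow> 'v \<Rightarrow> real" where
  "inflow N f v = (\<Sum>e\<in>{e\<in>arcs N. snd e = v}. f e)"

definition outflow :: "'v network \<Rightarrow> ('v \<times> 'v \<Rightarrow> real) \<Rightarrow> 'v \<Rightarrow> real" where
  "outflow N f v = (\<Sum>e\<in>{e\<in>arcs N. fst e = v}. f e)"

definition is_flow :: "'v network \<Rightarrow> ('v \<times> 'v \<Rightarrow> real) \<Rightarrow> bool" where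
  "is_flow N f \<longleftrightarrow>
     (\<forall>e\<in>arcs N. 0 \<le> f e \<and> ereal (f e) \<le> capacity N e) \<and>
     (\<forall>v\<in>verts N. inflow N f v = outflow N f v)"

definition flow_value :: "'v network \<Rightarrow> ('v \<times> 'v \<Rightarrow> real) \<Rightarrow> real" where
  "flow_value N f = outflow N f (source N) - inflow N f (source N)"

definition is_max_flow :: "'v network \<Rightarrow> ('v \<times> 'v \<Rightarrow> real) \<Rightarrow> bool" where
  "is_max_flow N f \<longleftrightarrow> is_flow N f \<and> (\<forall>f'. is_flow N f' \<longrightarrow> flow_value N f' \<le> flow_value N f)"

text \<open>
  No path from the source to the sink consists of arcs of infinite capacity only.  This is the
  condition under which a maximum flow exists.
\<close>

definition bounded_network :: "'v network \<Rightarrow> bool" where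
  "bounded_network N \<longleftrightarrow> (source N, sink N) \<notin> {e\<in>arcs N. capacity N e = \<infinity>}\<^sup>*"

definition residual_arcs :: "'v network \<Rightarrow> ('v \<times> 'v \<Rightarrow> real) \<Rightarrow> ('v \<times> 'v) set comp" where
  "residual_arcs N f =
     for_each (arcs N) (\<lambda>e. less_op (ereal (f e)) (capacity N e)) \<rhd> (\<lambda>unsaturated.
     for_each (arcs N) (\<lambda>e. less_op 0 (ereal (f e))) \<rhd> (\<lambda>positive.
     ret ({e\<in>arcs N. unsaturated e} \<union> {e\<in>arcs N. positive e}\<inverse>)))"

text \<open>A graph search handles every vertex and every residual arc at most once.\<close>

definition reachable_from_source :: "'v network \<Rightarrow> ('v \<times> 'v) set \<Rightarrow> 'v set comp" where
  "reachable_from_source N R =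
     charge (card (verts N \<union> {source N, sink N}) + card R) {v\<in>verts N. (source N, v) \<in> R\<^sup>*}"

text \<open>
  The part of the network on \<open>W\<close>, the source and the sink; every arc is inspected once.
\<close>

definition subnetwork :: "'v network \<Rightarrow> 'v set \<Rightarrow> 'v network comp" where
  "subnetwork N W =
     charge (card (verts N) + card (arcs N))
       (N\<lparr>verts := W,
          arcs := arcs N \<inter> (W \<union> {source N, sink N}) \<times> (W \<union> {source N, sink N})\<rparr>)"


section \<open>The algorithm\<close>

datatype vertex = Source | Sink | Var nat | Grp "nat set"

definition vars :: "vertex network \<Rightarrow> nat set" where
  "vars N = {j. Var j \<in> verts N}"

definition groups :: "vertex network \<Rightarrow> nat set set" where
  "groups N = {g. Grp g \<in> verts N}"

text \<open>
  Besides the multiplications \<open>lam * \<eta> g\<close>, building the graph takes one operation per vertex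
  and per arc.
\<close>

definition canonical_graph ::
    "nat \<Rightarrow> nat set set \<Rightarrow> (nat set \<Rightarrow> real) \<Rightarrow> real \<Rightarrow> (nat \<Rightarrow> real) \<Rightarrow> vertex network comp" where
  "canonical_graph p G \<eta> lam u =
     for_each G (\<lambda>g. mult_op lam (\<eta> g)) \<rhd> (\<lambda>c.
     let V = Var ` {1..p} \<union> Grp ` G;
         E = {(Source, Grp g) | g. g \<in> G} \<union> {(Grp g, Var j) | g j. g \<in> G \<and> j \<in> g} \<union>
             {(Var j, Sink) | j. j \<in> {1..p}}
     in charge (card V + card E)
          \<lparr>verts = V, arcs = E, source = Source, sink = Sink,
           capacity = (\<lambda>e. case e of (Source, Grp g) \<Rightarrow> ereal (c g) | _ \<Rightarrow> \<infinity>),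
           cost = (\<lambda>e x. case e of (Var j, Sink) \<Rightarrow> 1/2 * (u j - x)\<^sup>2 | _ \<Rightarrow> 0)\<rparr>)"

definition set_capacities :: "vertex network \<Rightarrow> (nat \<Rightarrow> real) \<Rightarrow> vertex network comp" where
  "set_capacities N \<gamma> =
     charge (card (vars N))
       (N\<lparr>capacity := (\<lambda>e. case e of (Var j, Sink) \<Rightarrow> ereal (\<gamma> j) | _ \<Rightarrow> capacity N e)\<rparr>)"

type_synonym max_flow_alg = "vertex network \<Rightarrow> (vertex \<times> vertex \<Rightarrow> real) comp"

text \<open>The arguments are the index set, the point to be projected and the bound on the sum.\<close>

type_synonym projection_alg = "nat set \<Rightarrow> (nat \<Rightarrow> real) \<Rightarrow> real \<Rightarrow> (nat \<Rightarrow> real) comp"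

partial_function (option) computeFlow ::
    "max_flow_alg \<Rightarrow> projection_alg \<Rightarrow> (nat \<Rightarrow> real) \<Rightarrow> (nat set \<Rightarrow> real) \<Rightarrow> real \<Rightarrow>
     vertex network \<Rightarrow> (nat \<Rightarrow> real) comp" where
  "computeFlow MF PR u \<eta> lam N =
     sum_ops (groups N) \<eta> \<rhd> (\<lambda>total.
     mult_op lam total \<rhd> (\<lambda>bound.
     PR (vars N) u bound \<rhd> (\<lambda>\<gamma>.
     set_capacities N \<gamma> \<rhd> (\<lambda>N1.
     MF N1 \<rhd> (\<lambda>f.
     let \<xi> = (\<lambda>j. f (Var j, Sink)) in
     for_each (vars N) (\<lambda>j. eq_op (\<xi> j) (\<gamma> j)) \<rhd> (\<lambda>agree.
     if \<exists>j\<in>vars N. \<not> agree j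
     then
       residual_arcs N1 f \<rhd> (\<lambda>R.
       reachable_from_source N1 R \<rhd> (\<lambda>Vplus.
       subnetwork N1 Vplus \<rhd> (\<lambda>Nplus.
       subnetwork N1 (verts N1 - Vplus) \<rhd> (\<lambda>Nminus.
       computeFlow MF PR u \<eta> lam Nplus \<rhd> (\<lambda>\<xi>plus.
       computeFlow MF PR u \<eta> lam Nminus \<rhd> (\<lambda>\<xi>minus.
       charge (card (vars N)) (\<lambda>j. if Var j \<in> Vplus then \<xi>plus j else \<xi>minus j)))))))
     else ret \<xi>))))))"

text \<open>
  The graph is built for the absolute values of the input, and the signs are restored in the
  output.
\<close>

definition algorithm1 ::
    "max_flow_alg \<Rightarrow> projection_alg \<Rightarrow> nat \<Rightarrow> (nat \<Rightarrow> real) \<Rightarrow> nat set set \<Rightarrow>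
     (nat set \<Rightarrow> real) \<Rightarrow> real \<Rightarrow> (nat \<Rightarrow> real) comp" where
  "algorithm1 MF PR p u G \<eta> lam =
     for_each {1..p} (\<lambda>j. less_op (ereal (u j)) 0) \<rhd> (\<lambda>negative.
     for_each {1..p} (\<lambda>j. if negative j then sub_op 0 (u j) else ret (u j)) \<rhd> (\<lambda>v.
     canonical_graph p G \<eta> lam v \<rhd> (\<lambda>N0.
     computeFlow MF PR v \<eta> lam N0 \<rhd> (\<lambda>\<xi>.
     for_each {1..p} (\<lambda>j. sub_op (v j) (\<xi> j)) \<rhd> (\<lambda>w.
     for_each {1..p} (\<lambda>j. if negative j then sub_op 0 (w j) else ret (w j)))))))"


section \<open>Correct polynomial-time subroutines\<close>

text \<open>
  The bound depends on the numbers of vertices and arcs only, not on the capacities: the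
  maximum flow algorithm is strongly polynomial.
\<close>

definition polytime_max_flow :: "max_flow_alg \<Rightarrow> bool" where
  "polytime_max_flow MF \<longleftrightarrow>
     (\<exists>P. \<forall>N. wf_network N \<and> bounded_network N \<longrightarrow>
        (\<exists>f n. MF N = Some (f, n) \<and> is_max_flow N f \<and>
           n \<le> eval2 P (card (verts N)) (card (arcs N))))"

definition feasible :: "nat set \<Rightarrow> real \<Rightarrow> (nat \<Rightarrow> real) \<Rightarrow> bool" where
  "feasible J b \<gamma> \<longleftrightarrow> (\<forall>j\<in>J. 0 \<le> \<gamma> j) \<and> sum \<gamma> J \<le> b"

definition is_projection :: "nat set \<Rightarrow> (nat \<Rightarrow> real) \<Rightarrow> real \<Rightarrow> (nat \<Rightarrow> real) \<Rightarrow> bool" where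
  "is_projection J u b \<gamma> \<longleftrightarrow>
     feasible J b \<gamma> \<and>
     (\<forall>\<gamma>'. feasible J b \<gamma>' \<longrightarrow>
        (\<Sum>j\<in>J. 1/2 * (u j - \<gamma> j)\<^sup>2) \<le> (\<Sum>j\<in>J. 1/2 * (u j - \<gamma>' j)\<^sup>2))"

definition polytime_projection :: "projection_alg \<Rightarrow> bool" where
  "polytime_projection PR \<longleftrightarrow>
     (\<exists>P :: nat poly. \<forall>J u b. finite J \<and> 0 \<le> b \<longrightarrow>
        (\<exists>\<gamma> n. PR J u b = Some (\<gamma>, n) \<and> is_projection J u b \<gamma> \<and> n \<le> poly P (card J)))"

end

theory Submission
  imports Defs
begin

text \<open>
  When the maximum flow does not attain \<open>\<gamma>\<close>, both sides of the minimum cut contain a vertex.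
  If every vertex were reachable in the residual graph, a variable whose sink arc is not saturated
  would yield an augmenting path.  If none were, all source arcs would be saturated, and the flow
  value \<open>lam * sum \<eta> (groups N)\<close> would be at least \<open>sum \<gamma> (vars N)\<close>, leaving no unsaturated sink
  arc.  Hence the recursion splits the vertices into two nonempty parts, and a network with \<open>n\<close>
  vertices causes at most \<open>2 * n - 1\<close> calls, each of polynomial cost.
\<close>

section \<open>Total-correctness judgements with an operation bound\<close>

text \<open>An upper bound instead of an exact count lets the rules compose. The postcondition
  carries along the facts on which the termination and cost of later steps depend.\<close>

definition runs_within :: "'a comp \<Rightarrow> nat \<Rightarrow> ('a \<Rightarrow> bool) \<Rightarrow> bool" where
  "runs_within m n P \<longleftrightarrow> (\<exists>x k. m = Some (x, k) \<and> k \<le> n \<and> P x)"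

lemma runs_within_charge: "k \<le> n \<Longrightarrow> P x \<Longrightarrow> runs_within (charge k x) n P"
  by (simp add: runs_within_def charge_def)

lemma runs_within_ret: "P x \<Longrightarrow> runs_within (ret x) n P"
  by (simp add: ret_def runs_within_charge)

text \<open>The bound \<open>b\<close> is uniform over all results that satisfy \<open>P\<close>.
  Iterating the rule yields a nested sum of the same shape as the program, which is why the bounds
  below are first stated in that form.\<close>

lemma runs_within_bind:
  assumes "runs_within m a P" and "\<And>x. P x \<Longrightarrow> runs_within (f x) b Q"
  shows "runs_within (m \<rhd> f) (a + b) Q"
proof -
  obtain x k where m: "m = Some (x, k)" "k \<le> a" "P x"
    using assms(1) by (auto simp: runs_within_def)
  obtain y l where f: "f x = Some (y, l)" "l \<le> b" "Q y"
    using assms(2)[OF m(3)] by (auto simp: runs_within_def)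
  show ?thesis
    using m f by (simp add: runs_within_def bind_comp_def)
qed

lemma runs_within_if:
  "(b \<Longrightarrow> runs_within m n P) \<Longrightarrow> (\<not> b \<Longrightarrow> runs_within m' n P) \<Longrightarrow>
    runs_within (if b then m else m') n P"
  by simp

lemma runs_within_mono:
  "runs_within m a P \<Longrightarrow> a \<le> b \<Longrightarrow> (\<And>x. P x \<Longrightarrow> Q x) \<Longrightarrow> runs_within m b Q"
  unfolding runs_within_def by (blast intro: order_trans)

lemma runs_within_for_each:
  assumes "card A * n \<le> k" and "\<And>x. x \<in> A \<Longrightarrow> runs_within (F x) n (P x)"
  shows "runs_within (for_each A F) k (\<lambda>t. \<forall>x\<in>A. P x (t x))"
proof -
  have pass: "F x \<noteq> None" "snd (the (F x)) \<le> n" "P x (fst (the (F x)))" if "x \<in> A" for x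
    using assms(2)[OF that] by (auto simp: runs_within_def)
  have "(\<Sum>x\<in>A. snd (the (F x))) \<le> card A * n"
    using sum_bounded_above[of A "\<lambda>x. snd (the (F x))" n] pass(2) by simp
  then show ?thesis
    using pass assms(1) by (auto simp: runs_within_def for_each_def)
qed

section \<open>Polynomial bounds\<close>

lemma poly_nat_mono:
  fixes P :: "nat poly"
  shows "x \<le> y \<Longrightarrow> poly P x \<le> poly P y"
  by (induction P) (auto intro!: add_mono mult_mono)

lemma eval2_pCons: "eval2 (pCons a P) x y = poly a y + x * eval2 P x y"
  by (simp add: eval2_def)

text \<open>This turns a bound in vertices and arcs into a bound in vertices alone, when
  \<open>S\<close> bounds the number of arcs. Following the Horner scheme, \<open>S\<close> is
  substituted for the second variable and the first is replaced by \<open>n\<close>; natural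
  coefficients make all of this monotone.\<close>

lemma eval2_le_poly:
  fixes P :: "nat poly poly" and S :: "nat poly"
  shows "\<exists>R. \<forall>x y n. x \<le> n \<and> y \<le> poly S n \<longrightarrow> eval2 P x y \<le> poly R n"
proof (induction P)
  case 0
  show ?case by (intro exI[of _ 0]) (simp add: eval2_def)
next
  case (pCons a P)
  then obtain R where R: "\<And>x y n. x \<le> n \<Longrightarrow> y \<le> poly S n \<Longrightarrow> eval2 P x y \<le> poly R n"
    by blast
  show ?case
    by (intro exI[of _ "pcompose a S + [:0, 1:] * R"])
       (auto simp: eval2_pCons poly_pcompose intro!: add_mono mult_mono poly_nat_mono R)
qed

text \<open>The count is most easily bounded in the number \<open>x + y\<close> of vertices of the
  canonical graph; this converts such a bound into one in two separate variables.\<close>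

lemma poly_sum_eval2:
  fixes R :: "nat poly"
  shows "\<exists>Q. \<forall>x y. poly R (x + y) = eval2 Q x y"
proof (induction R)
  case 0
  show ?case by (intro exI[of _ 0]) (simp add: eval2_def)
next
  case (pCons c R)
  then obtain Q where Q: "\<And>x y. poly R (x + y) = eval2 Q x y" by blast
  show ?case
    \<comment> \<open>The factor \<open>[:[:0, 1:], 1:]\<close> is the bivariate polynomial
      \<open>x + y\<close>: the outer variable stands for \<open>x\<close>, the inner one for
      \<open>y\<close>.\<close>
    by (intro exI[of _ "[:[:c:]:] + [:[:0, 1:], 1:] * Q"])
       (simp add: eval2_def Q[unfolded eval2_def] algebra_simps)
qed

section \<open>Perturbation of flows and augmenting paths\<close>

lemma wf_network_finite_arcs: "wf_network N \<Longrightarrow> finite (arcs N)"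
  unfolding wf_network_def by (elim conjE finite_subset) simp

lemma inflow_perturb:
  "finite (arcs N) \<Longrightarrow> inflow N (\<lambda>e. f e + c * d e) v = inflow N f v + c * inflow N d v"
  by (simp add: inflow_def sum.distrib sum_distrib_left)

lemma outflow_perturb:
  "finite (arcs N) \<Longrightarrow> outflow N (\<lambda>e. f e + c * d e) v = outflow N f v + c * outflow N d v"
  by (simp add: outflow_def sum.distrib sum_distrib_left)

lemma inflow_unit:
  "finite (arcs N) \<Longrightarrow> e \<in> arcs N \<Longrightarrow> inflow N (\<lambda>e'. of_bool (e' = e)) v = of_bool (snd e = v)"
  by (auto simp: inflow_def of_bool_def sum.delta)

lemma outflow_unit:
  "finite (arcs N) \<Longrightarrow> e \<in> arcs N \<Longrightarrow> outflow N (\<lambda>e'. of_bool (e' = e)) v = of_bool (fst e = v)"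
  by (auto simp: outflow_def of_bool_def sum.delta)

text \<open>The set computed by \<open>residual_arcs\<close>, freed from the operation
  count.\<close>

definition residual :: "'v network \<Rightarrow> ('v \<times> 'v \<Rightarrow> real) \<Rightarrow> ('v \<times> 'v) set" where
  "residual N f =
     {e\<in>arcs N. ereal (f e) < capacity N e} \<union> {e\<in>arcs N. 0 < f e}\<inverse>"

text \<open>
  The directions in which a flow can be perturbed form a convex cone, so the directions along
  residual arcs can be added up along any walk: no simple augmenting path is needed.
\<close>

definition feasible_direction :: "'v network \<Rightarrow> ('v \<times> 'v \<Rightarrow> real) \<Rightarrow> ('v \<times> 'v \<Rightarrow> real) \<Rightarrow> bool" where
  "feasible_direction N f d \<longleftrightarrow>
     (\<forall>e\<in>arcs N. (d e < 0 \<longrightarrow> 0 < f e) \<and> (d e > 0 \<longrightarrow> ereal (f e) < capacity N e))"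

text \<open>Each arc tolerates all sufficiently small positive steps: a strict inequality survives
  by continuity, and a tight constraint is only moved away from. As there are finitely many arcs, a
  common step exists.\<close>

lemma feasible_direction_step:
  assumes "is_flow N f" and "feasible_direction N f d" and "finite (arcs N)"
  shows "\<exists>\<epsilon>>0. \<forall>e\<in>arcs N. 0 \<le> f e + \<epsilon> * d e \<and> ereal (f e + \<epsilon> * d e) \<le> capacity N e"
proof -
  have "\<forall>\<^sub>F \<epsilon> in at_right 0. 0 \<le> f e + \<epsilon> * d e \<and> ereal (f e + \<epsilon> * d e) \<le> capacity N e"
    if e: "e \<in> arcs N" for e
  proof -
    have lim: "((\<lambda>\<epsilon>. f e + \<epsilon> * d e) \<longlongrightarrow> f e) (at_right 0)"
      by (rule tendsto_eq_intros refl | simp)+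
    have pos: "\<forall>\<^sub>F \<epsilon> in at_right (0::real). 0 < \<epsilon>"
      by (simp add: eventually_at_right_less)
    have fe: "0 \<le> f e" "ereal (f e) \<le> capacity N e"
      using assms(1) e by (auto simp: is_flow_def)
    have lower: "\<forall>\<^sub>F \<epsilon> in at_right 0. 0 \<le> f e + \<epsilon> * d e"
    proof (cases "d e < 0")
      case True
      then have "0 < f e"
        using assms(2) e by (simp add: feasible_direction_def)
      then show ?thesis
        using order_tendstoD(1)[OF lim, of 0] by (auto elim: eventually_mono)
    next
      case False
      then show ?thesis
        using pos fe by (auto elim!: eventually_mono)
    qed
    have upper: "\<forall>\<^sub>F \<epsilon> in at_right 0. ereal (f e + \<epsilon> * d e) \<le> capacity N e"
    proof (cases "d e > 0")
      case True
      then have "ereal (f e) < capacity N e"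
        using assms(2) e by (simp add: feasible_direction_def)
      then show ?thesis
        using order_tendstoD(2)[OF tendsto_ereal[OF lim]]
        by (metis (mono_tags, lifting) eventually_mono less_imp_le)
    next
      case False
      from pos show ?thesis
      proof eventually_elim
        case (elim \<epsilon>)
        then have "f e + \<epsilon> * d e \<le> f e"
          using False by (simp add: mult_nonneg_nonpos)
        then have "ereal (f e + \<epsilon> * d e) \<le> ereal (f e)"
          by simp
        then show ?case
          using fe(2) by (rule order_trans)
      qed
    qed
    show ?thesis
      using lower upper by (rule eventually_conj)
  qed
  then have "\<forall>\<^sub>F \<epsilon> in at_right 0.
      \<forall>e\<in>arcs N. 0 \<le> f e + \<epsilon> * d e \<and> ereal (f e + \<epsilon> * d e) \<le> capacity N e"
    using assms(3) by (simp add: eventually_ball_finite)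
  then have "\<forall>\<^sub>F \<epsilon> in at_right 0. 0 < \<epsilon> \<and>
      (\<forall>e\<in>arcs N. 0 \<le> f e + \<epsilon> * d e \<and> ereal (f e + \<epsilon> * d e) \<le> capacity N e)"
    by (intro eventually_conj eventually_at_right_less)
  then show ?thesis
    by (rule eventually_happens'[rotated]) simp
qed

text \<open>Induction along the walk, adding one signed unit of flow per residual arc. If an arc is
  used both ways, the contributions cancel, which keeps the direction feasible.\<close>

lemma residual_reachable_direction:
  assumes "finite (arcs N)" and "(a, v) \<in> (residual N f)\<^sup>*"
  shows "\<exists>d. feasible_direction N f d \<and>
    (\<forall>w. outflow N d w - inflow N d w = of_bool (w = a) - of_bool (w = v))"
  using assms(2)
proof (induction rule: rtrancl_induct)
  case base
  show ?case
    by (intro exI[of _ "\<lambda>_. 0"]) (simp add: feasible_direction_def inflow_def outflow_def)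
next
  case (step v w)
  then obtain d where d: "feasible_direction N f d"
    "\<And>x. outflow N d x - inflow N d x = of_bool (x = a) - of_bool (x = v)" by blast
  \<comment> \<open>The sign \<open>c\<close> records whether the residual arc runs along the
    network arc \<open>e\<close> or against it.\<close>
  obtain e and c :: real where e: "e \<in> arcs N"
    and c: "c = 1 \<and> e = (v, w) \<and> ereal (f e) < capacity N e \<or> c = -1 \<and> e = (w, v) \<and> 0 < f e"
  proof -
    consider "(v, w) \<in> arcs N" "ereal (f (v, w)) < capacity N (v, w)"
      | "(w, v) \<in> arcs N" "0 < f (w, v)"
      using step.hyps(2) by (auto simp: residual_def)
    then show thesis
      by cases (use that[of "(v, w)" 1] that[of "(w, v)" "-1"] in auto)
  qed
  define d' where "d' = (\<lambda>e'. d e' + c * of_bool (e' = e))"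
  have "feasible_direction N f d'"
    using d(1) c unfolding feasible_direction_def d'_def
    by (auto simp: of_bool_def split: if_splits)
  moreover have "outflow N d' x - inflow N d' x = of_bool (x = a) - of_bool (x = w)" for x
    using d(2)[of x] c unfolding d'_def inflow_perturb[OF assms(1)] outflow_perturb[OF assms(1)]
      inflow_unit[OF assms(1) e] outflow_unit[OF assms(1) e]
    by auto
  ultimately show ?case by blast
qed

text \<open>A step of length \<epsilon> in the direction belonging to an augmenting walk preserves
  conservation at the inner vertices and raises the value by \<epsilon>.\<close>

lemma max_flow_no_augmenting_path:
  assumes "wf_network N" and "is_max_flow N f"
  shows "(source N, sink N) \<notin> (residual N f)\<^sup>*"
proof
  assume "(source N, sink N) \<in> (residual N f)\<^sup>*"
  note fin = wf_network_finite_arcs[OF assms(1)]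
  obtain d where d: "feasible_direction N f d"
    "\<And>w. outflow N d w - inflow N d w = of_bool (w = source N) - of_bool (w = sink N)"
    using residual_reachable_direction[OF fin] \<open>(source N, sink N) \<in> _\<close> by blast
  have flow: "is_flow N f"
    using assms(2) by (simp add: is_max_flow_def)
  obtain \<epsilon> where \<epsilon>: "\<epsilon> > 0"
    "\<forall>e\<in>arcs N. 0 \<le> f e + \<epsilon> * d e \<and> ereal (f e + \<epsilon> * d e) \<le> capacity N e"
    using feasible_direction_step[OF flow d(1) fin] by blast
  define f' where "f' = (\<lambda>e. f e + \<epsilon> * d e)"
  have "inflow N f' v = outflow N f' v" if "v \<in> verts N" for v
  proof -
    have "v \<noteq> source N" "v \<noteq> sink N"
      using that assms(1) by (auto simp: wf_network_def)
    then have "outflow N d v = inflow N d v"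
      using d(2)[of v] by simp
    then show ?thesis
      using flow that by (simp add: f'_def inflow_perturb outflow_perturb fin is_flow_def)
  qed
  then have "is_flow N f'"
    using \<epsilon> by (simp add: is_flow_def f'_def)
  then have "flow_value N f' \<le> flow_value N f"
    using assms(2) by (simp add: is_max_flow_def)
  moreover have "flow_value N f' = flow_value N f + \<epsilon> * (outflow N d (source N) - inflow N d (source N))"
    by (simp add: flow_value_def f'_def inflow_perturb outflow_perturb fin algebra_simps)
  moreover have "outflow N d (source N) - inflow N d (source N) = 1"
    using d(2)[of "source N"] assms(1) by (simp add: wf_network_def)
  ultimately show False
    using \<epsilon>(1) by simp
qed

text \<open>Summed over all vertices, inflow and outflow both count every arc once; the inner
  vertices cancel by conservation.\<close>

lemma flow_source_sink:
  assumes "wf_network N" and "is_flow N f"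
  shows "outflow N f (source N) - inflow N f (source N) =
    inflow N f (sink N) - outflow N f (sink N)"
proof -
  let ?W = "verts N \<union> {source N, sink N}"
  have W: "finite ?W" "arcs N \<subseteq> ?W \<times> ?W" "source N \<noteq> sink N"
    "source N \<notin> verts N" "sink N \<notin> verts N" "finite (verts N)"
    using assms(1) by (auto simp: wf_network_def)
  note fin = wf_network_finite_arcs[OF assms(1)]
  have "sum (inflow N f) ?W = sum f (arcs N)"
    unfolding inflow_def using W by (intro sum.group fin) auto
  moreover have "sum (outflow N f) ?W = sum f (arcs N)"
    unfolding outflow_def using W by (intro sum.group fin) auto
  moreover have "sum (inflow N f) (verts N) = sum (outflow N f) (verts N)"
    using assms(2) by (simp add: is_flow_def)
  ultimately show ?thesis
    using W(3-6) by simp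
qed

section \<open>The invariant of the recursion\<close>

text \<open>This describes the networks that occur in the recursion. The arcs at the source and the
  sink are fixed by the vertices, whereas those between groups and variables are left open, because
  the cuts remove some of them.\<close>

definition canonical_part :: "(nat set \<Rightarrow> real) \<Rightarrow> real \<Rightarrow> vertex network \<Rightarrow> bool" where
  "canonical_part \<eta> lam N \<longleftrightarrow>
     wf_network N \<and> source N = Source \<and> sink N = Sink \<and>
     {e\<in>arcs N. fst e = Source} = {(Source, Grp g) | g. g \<in> groups N} \<and>
     {e\<in>arcs N. snd e = Sink} = {(Var j, Sink) | j. j \<in> vars N} \<and>
     (\<forall>e\<in>arcs N. fst e \<noteq> Sink \<and> snd e \<noteq> Source) \<and>
     (\<forall>g\<in>groups N. capacity N (Source, Grp g) = ereal (lam * \<eta> g)) \<and>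
     (\<forall>g\<in>groups N. 0 \<le> \<eta> g)"

lemma canonical_part_restrict:
  assumes "canonical_part \<eta> lam N" and "W \<subseteq> verts N"
  shows "canonical_part \<eta> lam (N\<lparr>verts := W,
    arcs := arcs N \<inter> (W \<union> {source N, sink N}) \<times> (W \<union> {source N, sink N})\<rparr>)"
proof -
  let ?N = "N\<lparr>verts := W,
    arcs := arcs N \<inter> (W \<union> {source N, sink N}) \<times> (W \<union> {source N, sink N})\<rparr>"
  have st: "source N = Source" "sink N = Sink"
    and src: "{e\<in>arcs N. fst e = Source} = {(Source, Grp g) | g. g \<in> groups N}"
    and snk: "{e\<in>arcs N. snd e = Sink} = {(Var j, Sink) | j. j \<in> vars N}"
    and ends: "\<And>e. e \<in> arcs N \<Longrightarrow> fst e \<noteq> Sink \<and> snd e \<noteq> Source"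
    and cap: "\<And>g. g \<in> groups N \<Longrightarrow> capacity N (Source, Grp g) = ereal (lam * \<eta> g) \<and> 0 \<le> \<eta> g"
    using assms(1) by (simp_all add: canonical_part_def)
  have sub: "groups ?N \<subseteq> groups N"
    using assms(2) by (auto simp: groups_def)
  have "wf_network N"
    using assms(1) by (simp add: canonical_part_def)
  then have wf: "wf_network ?N"
    using assms(2) finite_subset[OF assms(2)] unfolding wf_network_def by auto
  \<comment> \<open>Written as an intersection, the restricted set contains the original set of
    source arcs literally, so that \<open>src\<close> can rewrite it.\<close>
  have restrict_src: "{e\<in>arcs ?N. fst e = Source} =
      {e\<in>arcs N. fst e = Source} \<inter> UNIV \<times> (W \<union> {Source, Sink})"
    by (auto simp: st)
  have src': "{e\<in>arcs ?N. fst e = Source} = {(Source, Grp g) | g. g \<in> groups ?N}"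
    unfolding restrict_src src using assms(2) by (auto simp: groups_def)
  have restrict_snk: "{e\<in>arcs ?N. snd e = Sink} =
      {e\<in>arcs N. snd e = Sink} \<inter> (W \<union> {Source, Sink}) \<times> UNIV"
    by (auto simp: st)
  have snk': "{e\<in>arcs ?N. snd e = Sink} = {(Var j, Sink) | j. j \<in> vars ?N}"
    unfolding restrict_snk snk using assms(2) by (auto simp: vars_def)
  have "\<forall>e\<in>arcs ?N. fst e \<noteq> Sink \<and> snd e \<noteq> Source"
    using ends by auto
  moreover have "\<forall>g\<in>groups ?N. capacity ?N (Source, Grp g) = ereal (lam * \<eta> g)"
    "\<forall>g\<in>groups ?N. 0 \<le> \<eta> g"
    using cap sub by auto
  moreover have "source ?N = Source" "sink ?N = Sink"
    using st by simp_all
  ultimately show ?thesis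
    unfolding canonical_part_def by (intro conjI wf src' snk')
qed

text \<open>The network produced by \<open>set_capacities\<close>, without its cost, so that
  postconditions can refer to it.\<close>

definition with_capacities :: "vertex network \<Rightarrow> (nat \<Rightarrow> real) \<Rightarrow> vertex network" where
  "with_capacities N \<gamma> =
     N\<lparr>capacity := (\<lambda>e. case e of (Var j, Sink) \<Rightarrow> ereal (\<gamma> j) | _ \<Rightarrow> capacity N e)\<rparr>"

lemma with_capacities_simps [simp]:
  "verts (with_capacities N \<gamma>) = verts N" "arcs (with_capacities N \<gamma>) = arcs N"
  "source (with_capacities N \<gamma>) = source N" "sink (with_capacities N \<gamma>) = sink N"
  "groups (with_capacities N \<gamma>) = groups N" "vars (with_capacities N \<gamma>) = vars N"
  "capacity (with_capacities N \<gamma>) (Var j, Sink) = ereal (\<gamma> j)"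
  "capacity (with_capacities N \<gamma>) (Source, v) = capacity N (Source, v)"
  by (simp_all add: with_capacities_def groups_def vars_def)

text \<open>Only capacities at the sink change, while the invariant prescribes those at the source;
  nonnegativity of \<gamma> keeps the network well-formed.\<close>

lemma canonical_part_with_capacities:
  assumes "canonical_part \<eta> lam N" and "\<And>j. j \<in> vars N \<Longrightarrow> 0 \<le> \<gamma> j"
  shows "canonical_part \<eta> lam (with_capacities N \<gamma>)"
proof -
  have snk: "{e\<in>arcs N. snd e = Sink} = {(Var j, Sink) | j. j \<in> vars N}"
    using assms(1) by (simp add: canonical_part_def)
  have "0 \<le> capacity (with_capacities N \<gamma>) e" if e: "e \<in> arcs N" for e
  proof (cases "snd e = Sink")
    case True
    then obtain j where "e = (Var j, Sink)" "j \<in> vars N"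
      using snk e by blast
    then show ?thesis using assms(2) by simp
  next
    case False
    then have "capacity (with_capacities N \<gamma>) e = capacity N e"
      by (auto simp: with_capacities_def split: prod.split vertex.split)
    then show ?thesis
      using assms(1) e by (simp add: canonical_part_def wf_network_def)
  qed
  moreover have "wf_network N"
    using assms(1) by (simp add: canonical_part_def)
  ultimately have "wf_network (with_capacities N \<gamma>)"
    by (simp add: wf_network_def)
  then show ?thesis
    using assms(1) by (simp add: canonical_part_def)
qed

text \<open>All arcs leaving the source have finite capacity, so a path of infinite capacity cannot
  take its first step.\<close>

lemma canonical_part_bounded:
  assumes "canonical_part \<eta> lam N"
  shows "bounded_network N"
proof -
  have src: "{e\<in>arcs N. fst e = Source} = {(Source, Grp g) | g. g \<in> groups N}"
    using assms by (simp add: canonical_part_def)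
  have "capacity N (Source, v) \<noteq> \<infinity>" if "(Source, v) \<in> arcs N" for v
  proof -
    have "(Source, v) \<in> {e\<in>arcs N. fst e = Source}"
      using that by simp
    then obtain g where "g \<in> groups N" "v = Grp g"
      unfolding src by blast
    then show ?thesis
      using assms by (simp add: canonical_part_def)
  qed
  then have "(Source, v) \<notin> {e\<in>arcs N. capacity N e = \<infinity>}" for v
    by simp
  then have "(Source, Sink) \<notin> {e\<in>arcs N. capacity N e = \<infinity>}\<^sup>*"
    by (metis converse_rtranclE vertex.distinct(1))
  then show ?thesis
    using assms by (simp add: bounded_network_def canonical_part_def)
qed

text \<open>The crude quadratic bound on the arcs (all pairs of vertices, with source and sink
  added) makes the vertex count the only size that the recursion has to track.\<close>

lemma canonical_part_finite:
  assumes "canonical_part \<eta> lam N"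
  shows "finite (verts N)" "finite (vars N)"
    "card (groups N) \<le> card (verts N)" "card (vars N) \<le> card (verts N)"
    "card (arcs N) \<le> (card (verts N) + 2)\<^sup>2"
proof -
  show fin: "finite (verts N)"
    using assms by (simp add: canonical_part_def wf_network_def)
  have sub: "Grp ` groups N \<subseteq> verts N" "Var ` vars N \<subseteq> verts N"
    by (auto simp: groups_def vars_def)
  have inj: "inj_on Grp (groups N)" "inj_on Var (vars N)"
    by (auto simp: inj_on_def)
  show "card (groups N) \<le> card (verts N)"
    using fin sub(1) inj(1) by (metis card_image card_mono)
  show "finite (vars N)" "card (vars N) \<le> card (verts N)"
    using fin sub(2) inj(2) by (meson finite_imageD finite_subset, metis card_image card_mono)
  let ?W = "verts N \<union> {source N, sink N}"
  have "card (arcs N) \<le> card (?W \<times> ?W)"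
    using assms fin by (intro card_mono) (auto simp: canonical_part_def wf_network_def)
  also have "\<dots> = (card ?W)\<^sup>2"
    by (simp only: card_cartesian_product power2_eq_square)
  also have "card ?W \<le> card (verts N) + 2"
    using card_Un_le[of "verts N" "{source N, sink N}"] card_insert_le_m1[of 2 "{sink N}" "source N"]
    by simp
  then have "(card ?W)\<^sup>2 \<le> (card (verts N) + 2)\<^sup>2"
    by (rule power_mono) simp
  finally show "card (arcs N) \<le> (card (verts N) + 2)\<^sup>2" .
qed

section \<open>Both sides of the minimum cut are nonempty\<close>

lemma min_cut_proper:
  assumes N: "canonical_part \<eta> lam N" and \<gamma>: "feasible (vars N) (lam * sum \<eta> (groups N)) \<gamma>"
    and f: "is_max_flow (with_capacities N \<gamma>) f"
    and j: "j \<in> vars N" "f (Var j, Sink) \<noteq> \<gamma> j"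
    and W: "W = {v\<in>verts N. (source N, v) \<in> (residual (with_capacities N \<gamma>) f)\<^sup>*}"
  shows "W \<noteq> {}" and "W \<noteq> verts N"
proof -
  let ?N = "with_capacities N \<gamma>"
  let ?R = "residual ?N f"
  have st: "source N = Source" "sink N = Sink"
    and src: "{e\<in>arcs N. fst e = Source} = {(Source, Grp g) | g. g \<in> groups N}"
    and snk: "{e\<in>arcs N. snd e = Sink} = {(Var j, Sink) | j. j \<in> vars N}"
    and no_in: "{e\<in>arcs N. snd e = Source} = {}"
    and no_out: "{e\<in>arcs N. fst e = Sink} = {}"
    and cap: "\<And>g. g \<in> groups N \<Longrightarrow> capacity N (Source, Grp g) = ereal (lam * \<eta> g)"
    using N by (auto simp: canonical_part_def)
  have N': "canonical_part \<eta> lam ?N"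
    using canonical_part_with_capacities[OF N] \<gamma> by (simp add: feasible_def)
  then have wf: "wf_network ?N"
    by (simp add: canonical_part_def)
  have flow: "is_flow ?N f"
    using f by (simp add: is_max_flow_def)
  have sink_arc: "(Var i, Sink) \<in> arcs N" "f (Var i, Sink) \<le> \<gamma> i" if "i \<in> vars N" for i
  proof -
    show "(Var i, Sink) \<in> arcs N" using snk that by blast
    then show "f (Var i, Sink) \<le> \<gamma> i"
      using flow by (fastforce simp: is_flow_def)
  qed
  have unsaturated: "f (Var j, Sink) < \<gamma> j"
    using sink_arc(2)[OF j(1)] j(2) by simp
  show "W \<noteq> verts N"
  proof
    assume "W = verts N"
    then have "(Source, Var j) \<in> ?R\<^sup>*"
      using j(1) W st by (auto simp: vars_def)
    moreover have "(Var j, Sink) \<in> ?R"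
      using sink_arc(1)[OF j(1)] unsaturated by (simp add: residual_def)
    ultimately have "(source ?N, sink ?N) \<in> ?R\<^sup>*"
      using st by simp
    then show False
      using max_flow_no_augmenting_path[OF wf f] by contradiction
  qed
  show "W \<noteq> {}"
  proof
    assume "W = {}"
    have "f (Source, Grp g) = lam * \<eta> g" if g: "g \<in> groups N" for g
    proof -
      have arc: "(Source, Grp g) \<in> arcs N"
        using src g by blast
      have "Grp g \<notin> W" "Grp g \<in> verts N"
        using \<open>W = {}\<close> g by (auto simp: groups_def)
      \<comment> \<open>A residual arc from the source would put \<open>Grp g\<close> into
        \<open>W\<close> in a single step.\<close>
      then have "(Source, Grp g) \<notin> ?R"
        using W st by auto
      then have "lam * \<eta> g \<le> f (Source, Grp g)"
        using arc cap[OF g] by (simp add: residual_def not_less)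
      moreover have "f (Source, Grp g) \<le> lam * \<eta> g"
        using flow arc cap[OF g] by (fastforce simp: is_flow_def)
      ultimately show ?thesis by simp
    qed
    moreover have "outflow ?N f Source = (\<Sum>g\<in>groups N. f (Source, Grp g))"
      unfolding outflow_def with_capacities_simps src
      by (rule sum.reindex_cong[of "\<lambda>g. (Source, Grp g)"]) (auto simp: inj_on_def)
    ultimately have out: "outflow ?N f Source = lam * sum \<eta> (groups N)"
      by (simp add: sum_distrib_left)
    have "inflow ?N f Sink = (\<Sum>i\<in>vars N. f (Var i, Sink))"
      unfolding inflow_def with_capacities_simps snk
      by (rule sum.reindex_cong[of "\<lambda>i. (Var i, Sink)"]) (auto simp: inj_on_def)
    \<comment> \<open>Strictness comes from \<open>j\<close>; every other variable contributes at
      most its capacity.\<close>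
    also have "\<dots> < sum \<gamma> (vars N)"
      using canonical_part_finite(2)[OF N] j(1) unsaturated sink_arc(2)
      by (intro sum_strict_mono_ex1) auto
    also have "\<dots> \<le> lam * sum \<eta> (groups N)"
      using \<gamma> by (simp add: feasible_def)
    finally show False
      \<comment> \<open>No arc enters the source or leaves the sink, so the outflow of the source
        would equal the strictly smaller inflow of the sink.\<close>
      using flow_source_sink[OF wf flow] out st
      by (simp add: inflow_def[of _ _ Source] outflow_def[of _ _ Sink] no_in no_out)
  qed
qed

section \<open>Operation count of the recursion\<close>

lemma runs_within_residual_arcs:
  assumes "card (arcs N) \<le> a"
  shows "runs_within (residual_arcs N f) (2 * a) (\<lambda>R. R = residual N f)"
proof -
  have "runs_within (residual_arcs N f) (a + (a + 0)) (\<lambda>R. R = residual N f)"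
    unfolding residual_arcs_def
  proof (intro runs_within_bind runs_within_ret)
    show "runs_within (for_each (arcs N) (\<lambda>e. less_op (ereal (f e)) (capacity N e))) a
        (\<lambda>t. \<forall>e\<in>arcs N. t e = (ereal (f e) < capacity N e))"
      using assms by (intro runs_within_for_each[where n = 1])
        (auto simp: less_op_def intro: runs_within_charge)
    show "runs_within (for_each (arcs N) (\<lambda>e. less_op 0 (ereal (f e)))) a
        (\<lambda>t. \<forall>e\<in>arcs N. t e = (0 < f e))"
      using assms by (intro runs_within_for_each[where n = 1])
        (auto simp: less_op_def intro: runs_within_charge)
  qed (auto simp: residual_def)
  then show ?thesis by (simp add: mult_2)
qed

lemma card_residual_le:
  assumes "finite (arcs N)"
  shows "card (residual N f) \<le> 2 * card (arcs N)"
proof -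
  have "card (residual N f) \<le> card (arcs N \<union> (arcs N)\<inverse>)"
    using assms by (intro card_mono) (auto simp: residual_def)
  also have "\<dots> \<le> 2 * card (arcs N)"
    using card_Un_le[of "arcs N" "(arcs N)\<inverse>"] by simp
  finally show ?thesis .
qed


text \<open>The cap \<open>M\<close> on the vertex count is the same at every level, so
  \<open>mf\<close> and \<open>pr\<close> stay constant. The calls form a binary tree whose nodes
  have nonempty vertex sets and whose branchings partition them; \<open>2 * n - 1\<close> bounds its
  size, and the other factor bounds the cost of one call.\<close>

lemma runs_within_computeFlow:
  fixes M mf pr :: nat and MF :: max_flow_alg and PR :: projection_alg
  assumes MF: "\<And>N. wf_network N \<Longrightarrow> bounded_network N \<Longrightarrow> card (verts N) \<le> M \<Longrightarrow>
      card (arcs N) \<le> (M + 2)\<^sup>2 \<Longrightarrow> runs_within (MF N) mf (is_max_flow N)"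
    and PR: "\<And>J b. finite J \<Longrightarrow> card J \<le> M \<Longrightarrow> 0 \<le> b \<Longrightarrow>
      runs_within (PR J u b) pr (is_projection J u b)"
    and lam: "0 \<le> lam"
    and N: "canonical_part \<eta> lam N" "verts N \<noteq> {}" "card (verts N) \<le> M"
  shows "runs_within (computeFlow MF PR u \<eta> lam N)
    ((2 * card (verts N) - 1) * (mf + pr + 7 * M + 3 + 6 * (M + 2)\<^sup>2)) (\<lambda>_. True)"
  using N
proof (induction "card (verts N)" arbitrary: N rule: less_induct)
  case less
  let ?B = "mf + pr + 7 * M + 3 + 6 * (M + 2)\<^sup>2"
  let ?n = "card (verts N)"
  \<comment> \<open>Cost of cutting: residual graph, search, two subnetworks and merging the
    results. The steps before it cost \<open>mf + pr + 3 * M + 1\<close>, and together they give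
    \<open>?B\<close>.\<close>
  let ?split = "6 * (M + 2)\<^sup>2 + 4 * M + 2"
  note N = less.prems(1) and bounds = canonical_part_finite[OF less.prems(1)]
  have "0 < ?n" using less.prems(2) bounds(1) by (simp add: card_gt_0_iff)
  have groups_le: "card (groups N) \<le> M" and vars_le: "card (vars N) \<le> M"
    using bounds less.prems(3) by auto
  have arcs_le: "card (arcs N) \<le> (M + 2)\<^sup>2"
    using bounds(5) less.prems(3) by (meson add_le_mono1 order_trans power_mono zero_le)
  let ?b = "lam * sum \<eta> (groups N)"
  have "0 \<le> ?b"
    using N lam by (intro mult_nonneg_nonneg sum_nonneg) (auto simp: canonical_part_def)
  \<comment> \<open>The recursive branch is stated for arbitrary intermediate results that satisfy
    the postconditions of the earlier steps; it then fits the last goal left by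
    \<open>runs_within_bind\<close>.\<close>
  have split: "runs_within
      (residual_arcs N1 f \<rhd> (\<lambda>R.
       reachable_from_source N1 R \<rhd> (\<lambda>Vplus.
       subnetwork N1 Vplus \<rhd> (\<lambda>Nplus.
       subnetwork N1 (verts N1 - Vplus) \<rhd> (\<lambda>Nminus.
       computeFlow MF PR u \<eta> lam Nplus \<rhd> (\<lambda>\<xi>plus.
       computeFlow MF PR u \<eta> lam Nminus \<rhd> (\<lambda>\<xi>minus.
       charge (card (vars N)) (\<lambda>j. if Var j \<in> Vplus then \<xi>plus j else \<xi>minus j))))))))
      (?split + (2 * ?n - 2) * ?B) (\<lambda>_. True)"
    if \<gamma>: "feasible (vars N) ?b \<gamma>" and N1: "N1 = with_capacities N \<gamma>"
      and f: "is_max_flow (with_capacities N \<gamma>) f"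
      and agree: "\<forall>j\<in>vars N. agree j = (f (Var j, Sink) = \<gamma> j)" "\<exists>j\<in>vars N. \<not> agree j"
    for \<gamma> f N1 agree
  proof -
    let ?N = "with_capacities N \<gamma>"
    let ?R = "residual ?N f"
    obtain j where j: "j \<in> vars N" "f (Var j, Sink) \<noteq> \<gamma> j"
      using agree by blast
    define W where "W = {v\<in>verts N. (source N, v) \<in> ?R\<^sup>*}"
    define part where "part X = ?N\<lparr>verts := X,
      arcs := arcs ?N \<inter> (X \<union> {source ?N, sink ?N}) \<times> (X \<union> {source ?N, sink ?N})\<rparr>" for X
    have W: "W \<subseteq> verts N" "W \<noteq> {}" "W \<noteq> verts N"
      using min_cut_proper[OF N \<gamma> f j W_def] by (auto simp: W_def)
    have finW: "finite W" using W(1) bounds(1) by (rule finite_subset)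
    have card_part: "card (verts N - W) = ?n - card W" "0 < card W" "card W < ?n"
      using W finW bounds(1) by (auto simp: card_Diff_subset card_gt_0_iff intro: psubset_card_mono)
    have N': "canonical_part \<eta> lam ?N"
      using canonical_part_with_capacities[OF N] \<gamma> by (simp add: feasible_def)
    have rec: "runs_within (computeFlow MF PR u \<eta> lam (part X)) ((2 * card X - 1) * ?B) (\<lambda>_. True)"
      if "X \<subseteq> verts N" "X \<noteq> {}" "card X < ?n" for X
      using less.hyps[of "part X"] canonical_part_restrict[OF N', of X] that less.prems(3)
      by (simp add: part_def)
    have cardR: "card ?R \<le> 2 * (M + 2)\<^sup>2"
      using card_residual_le[of ?N f] arcs_le N wf_network_finite_arcs
      by (fastforce simp: canonical_part_def)
    have cardV: "card (verts N \<union> {source N, sink N}) \<le> M + 2"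
      using less.prems(3) card_Un_le[of "verts N" "{source N, sink N}"]
        card_insert_le_m1[of 2 "{sink N}" "source N"] by simp
    have "runs_within
      (residual_arcs ?N f \<rhd> (\<lambda>R.
       reachable_from_source ?N R \<rhd> (\<lambda>Vplus.
       subnetwork ?N Vplus \<rhd> (\<lambda>Nplus.
       subnetwork ?N (verts ?N - Vplus) \<rhd> (\<lambda>Nminus.
       computeFlow MF PR u \<eta> lam Nplus \<rhd> (\<lambda>\<xi>plus.
       computeFlow MF PR u \<eta> lam Nminus \<rhd> (\<lambda>\<xi>minus.
       charge (card (vars N)) (\<lambda>j. if Var j \<in> Vplus then \<xi>plus j else \<xi>minus j))))))))
      (2 * (M + 2)\<^sup>2 + ((M + 2 + 2 * (M + 2)\<^sup>2) + ((M + (M + 2)\<^sup>2) + ((M + (M + 2)\<^sup>2) +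
        ((2 * card W - 1) * ?B + ((2 * card (verts N - W) - 1) * ?B + M)))))) (\<lambda>_. True)"
    proof (intro runs_within_bind)
      show "runs_within (residual_arcs ?N f) (2 * (M + 2)\<^sup>2) (\<lambda>R. R = ?R)"
        using arcs_le by (intro runs_within_residual_arcs) simp
      show "runs_within (reachable_from_source ?N R) (M + 2 + 2 * (M + 2)\<^sup>2) (\<lambda>V. V = W)"
        if "R = ?R" for R
        unfolding reachable_from_source_def that
        using cardR cardV by (intro runs_within_charge add_mono) (auto simp: W_def)
      show "runs_within (subnetwork ?N V) (M + (M + 2)\<^sup>2) (\<lambda>N. N = part W)" if "V = W" for V
        unfolding subnetwork_def that part_def
        using less.prems(3) arcs_le by (intro runs_within_charge add_mono) simp_all
      show "runs_within (subnetwork ?N (verts ?N - V)) (M + (M + 2)\<^sup>2)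
          (\<lambda>N'. N' = part (verts N - W))" if "V = W" for V
        unfolding subnetwork_def that part_def
        using less.prems(3) arcs_le by (intro runs_within_charge add_mono) simp_all
      show "runs_within (computeFlow MF PR u \<eta> lam N') ((2 * card W - 1) * ?B) (\<lambda>_. True)"
        if "N' = part W" for N'
        unfolding that using W card_part by (intro rec) auto
      show "runs_within (computeFlow MF PR u \<eta> lam N') ((2 * card (verts N - W) - 1) * ?B) (\<lambda>_. True)"
        if "N' = part (verts N - W)" for N'
        unfolding that using W card_part by (intro rec) auto
      show "runs_within (charge (card (vars N)) x) M (\<lambda>_. True)" for x :: "nat \<Rightarrow> real"
        using vars_le by (intro runs_within_charge) simp_all
    qed
    \<comment> \<open>Natural subtraction is harmless here, since both parts are nonempty. The
      missing \<open>?B\<close> is the cost of the current call.\<close>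
    moreover have "(2 * card W - 1) * ?B + (2 * card (verts N - W) - 1) * ?B = (2 * ?n - 2) * ?B"
      unfolding add_mult_distrib[symmetric] using card_part by (intro arg_cong2[of _ _ _ _ "(*)"]) auto
    ultimately show ?thesis
      unfolding N1 by (elim runs_within_mono) auto
  qed
  have "runs_within (computeFlow MF PR u \<eta> lam N)
      (M + (1 + (pr + (M + (mf + (M + (?split + (2 * ?n - 2) * ?B))))))) (\<lambda>_. True)"
    unfolding computeFlow.simps[of MF PR u \<eta> lam N] Let_def
  proof (intro runs_within_bind)
    show "runs_within (sum_ops (groups N) \<eta>) M (\<lambda>total. total = sum \<eta> (groups N))"
      using groups_le by (simp add: sum_ops_def runs_within_charge)
    show "runs_within (mult_op lam total) 1 (\<lambda>b. b = ?b)" if "total = sum \<eta> (groups N)" for total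
      using that by (simp add: mult_op_def runs_within_charge)
    show "runs_within (PR (vars N) u b) pr (feasible (vars N) ?b)" if "b = ?b" for b
      unfolding that using PR[OF bounds(2) vars_le \<open>0 \<le> ?b\<close>]
      by (rule runs_within_mono) (simp_all add: is_projection_def)
    show "runs_within (set_capacities N \<gamma>) M (\<lambda>N1. N1 = with_capacities N \<gamma>)" for \<gamma>
      using vars_le by (simp add: set_capacities_def with_capacities_def runs_within_charge)
    show "runs_within (MF N1) mf (is_max_flow (with_capacities N \<gamma>))"
      if "feasible (vars N) ?b \<gamma>" "N1 = with_capacities N \<gamma>" for \<gamma> N1
    proof -
      have "canonical_part \<eta> lam N1"
        using canonical_part_with_capacities[OF N] that by (simp add: feasible_def)
      then have "wf_network N1" "bounded_network N1"
        by (simp add: canonical_part_def, rule canonical_part_bounded)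
      then show ?thesis
        using MF[of N1] less.prems(3) arcs_le that(2) by simp
    qed
    show "runs_within (for_each (vars N) (\<lambda>j. eq_op (f (Var j, Sink)) (\<gamma> j))) M
        (\<lambda>t. \<forall>j\<in>vars N. t j = (f (Var j, Sink) = \<gamma> j))" for f \<gamma>
      using vars_le by (intro runs_within_for_each[where n = 1])
        (simp_all add: eq_op_def runs_within_charge)
  qed (rule runs_within_if, rule split, assumption+, rule runs_within_ret, rule TrueI)
  moreover have "M + (1 + (pr + (M + (mf + (M + (?split + (2 * ?n - 2) * ?B)))))) =
      ?B + (2 * ?n - 2) * ?B"
    by simp
  moreover have "\<dots> = (2 * ?n - 1) * ?B"
    using \<open>0 < ?n\<close> by (cases ?n) auto
  ultimately show ?case
    by argo
qed

section \<open>The initial graph and the total count\<close>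

text \<open>This establishes the invariant for the first call. The arcs are not counted exactly;
  their number is bounded by the quadratic estimate that follows from the invariant itself.\<close>

lemma runs_within_canonical_graph:
  assumes "G \<subseteq> Pow {1..p}" and "\<And>g. g \<in> G \<Longrightarrow> 0 \<le> \<eta> g" and "0 \<le> lam"
  shows "runs_within (canonical_graph p G \<eta> lam u) (card G + (p + card G + (p + card G + 2)\<^sup>2))
    (\<lambda>N. canonical_part \<eta> lam N \<and> card (verts N) = p + card G)"
  unfolding canonical_graph_def Let_def
proof (rule runs_within_bind)
  show "runs_within (for_each G (\<lambda>g. mult_op lam (\<eta> g))) (card G) (\<lambda>c. \<forall>g\<in>G. c g = lam * \<eta> g)"
    by (intro runs_within_for_each[where n = 1]) (simp_all add: mult_op_def runs_within_charge)
next
  fix c :: "nat set \<Rightarrow> real"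
  assume c: "\<forall>g\<in>G. c g = lam * \<eta> g"
  let ?V = "Var ` {1..p} \<union> Grp ` G"
  let ?E = "{(Source, Grp g) | g. g \<in> G} \<union> {(Grp g, Var j) | g j. g \<in> G \<and> j \<in> g} \<union>
    {(Var j, Sink) | j. j \<in> {1..p}}"
  let ?N = "\<lparr>verts = ?V, arcs = ?E, source = Source, sink = Sink,
    capacity = (\<lambda>e. case e of (Source, Grp g) \<Rightarrow> ereal (c g) | _ \<Rightarrow> \<infinity>),
    cost = (\<lambda>e x. case e of (Var j, Sink) \<Rightarrow> 1/2 * (u j - x)\<^sup>2 | _ \<Rightarrow> 0)\<rparr>"
  have finG: "finite G"
    using assms(1) by (rule finite_subset) simp
  have "card ?V = p + card G"
    using finG by (subst card_Un_disjoint) (auto simp: card_image inj_on_def)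
  moreover have N: "canonical_part \<eta> lam ?N"
    unfolding canonical_part_def
  proof (intro conjI)
    have nonneg: "\<forall>e\<in>?E. 0 \<le> capacity ?N e"
      using assms c by auto
    have ends: "?E \<subseteq> (?V \<union> {Source, Sink}) \<times> (?V \<union> {Source, Sink})"
      using assms(1) by blast
    show "wf_network ?N"
      unfolding wf_network_def network.simps using nonneg ends finG
      by (intro conjI) (assumption | simp | blast)+
    have "groups ?N = G" "vars ?N = {1..p}"
      by (auto simp: groups_def vars_def)
    then show "{e\<in>arcs ?N. fst e = Source} = {(Source, Grp g) | g. g \<in> groups ?N}"
      "{e\<in>arcs ?N. snd e = Sink} = {(Var j, Sink) | j. j \<in> vars ?N}"
      "\<forall>g\<in>groups ?N. capacity ?N (Source, Grp g) = ereal (lam * \<eta> g)"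
      "\<forall>g\<in>groups ?N. 0 \<le> \<eta> g"
      using c assms(2) by auto
  qed auto
  moreover have "card ?E \<le> (p + card G + 2)\<^sup>2"
    using canonical_part_finite(5)[OF N] \<open>card ?V = p + card G\<close> by simp
  ultimately show "runs_within (charge (card ?V + card ?E) ?N)
      (p + card G + (p + card G + 2)\<^sup>2)
      (\<lambda>N. canonical_part \<eta> lam N \<and> card (verts N) = p + card G)"
    by (intro runs_within_charge) simp_all
qed

theorem proposition6:
  fixes MF :: max_flow_alg and PR :: projection_alg
  assumes "polytime_max_flow MF" and "polytime_projection PR"
  shows "\<exists>Q :: nat poly poly.
    \<forall>(p::nat) (G :: nat set set) (\<eta> :: nat set \<Rightarrow> real) (lam::real) (u :: nat \<Rightarrow> real).
      p \<ge> 1 \<and> G \<subseteq> Pow {1..p} \<and> {} \<notin> G \<and> (\<forall>g\<in>G. \<eta> g > 0) \<and> lam > 0 \<longrightarrow>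
      (\<exists>w n. algorithm1 MF PR p u G \<eta> lam = Some (w, n) \<and> n \<le> eval2 Q p (card G))"
proof -
  obtain PM where PM: "\<And>N. wf_network N \<Longrightarrow> bounded_network N \<Longrightarrow>
      runs_within (MF N) (eval2 PM (card (verts N)) (card (arcs N))) (is_max_flow N)"
    using assms(1) unfolding polytime_max_flow_def runs_within_def by metis
  obtain S where S: "\<And>J u b. finite J \<Longrightarrow> 0 \<le> b \<Longrightarrow>
      runs_within (PR J u b) (poly S (card J)) (is_projection J u b)"
    using assms(2) unfolding polytime_projection_def runs_within_def by metis
  \<comment> \<open>\<open>R\<close> bounds the cost of a maximum flow in any network with at most
    \<open>n\<close> vertices and \<open>(n + 2)\<^sup>2\<close> arcs.\<close>
  obtain R where R: "\<And>x y n. x \<le> n \<Longrightarrow> y \<le> (n + 2)\<^sup>2 \<Longrightarrow> eval2 PM x y \<le> poly R n"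
    using eval2_le_poly[of "[:2, 1:]\<^sup>2" PM] by (auto simp: add.commute[of 2])
  \<comment> \<open>\<open>B\<close> is the cost of one call of \<open>computeFlow\<close>, with
    \<open>M\<close> set to \<open>n\<close>.\<close>
  define B where "B = R + S + [:3, 7:] + smult 6 ([:2, 1:]\<^sup>2)"
  have B: "poly B n = poly R n + poly S n + 7 * n + 3 + 6 * (n + 2)\<^sup>2" for n
    by (simp add: B_def algebra_simps)
  \<comment> \<open>The term \<open>6 * n\<close> covers the four loops over the variables and the
    linear part of building the graph, \<open>2 * n * B\<close> the recursion.\<close>
  define T where "T = [:0, 6:] + [:2, 1:]\<^sup>2 + [:0, 2:] * B"
  have T: "poly T n = 6 * n + (n + 2)\<^sup>2 + 2 * n * poly B n" for n
    by (simp add: T_def algebra_simps)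
  obtain Q where Q: "\<And>x y. poly T (x + y) = eval2 Q x y"
    using poly_sum_eval2 by blast
  have "runs_within (algorithm1 MF PR p u G \<eta> lam) (eval2 Q p (card G)) (\<lambda>_. True)"
    if p: "p \<ge> 1" and G: "G \<subseteq> Pow {1..p}" "\<forall>g\<in>G. \<eta> g > 0" and lam: "lam > 0"
    for p u G and \<eta> :: "nat set \<Rightarrow> real" and lam
  proof -
    let ?M = "p + card G"
    have "runs_within (algorithm1 MF PR p u G \<eta> lam)
      (p + (p + ((card G + (?M + (?M + 2)\<^sup>2)) + ((2 * ?M - 1) * poly B ?M + (p + p))))) (\<lambda>_. True)"
      unfolding algorithm1_def
    proof (intro runs_within_bind)
      \<comment> \<open>The subroutine bounds are uniform in the input vector, so the loops over the
        variables carry trivial postconditions.\<close>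
      show "runs_within (for_each {1..p} (\<lambda>j. less_op (ereal (u j)) 0)) p
          (\<lambda>t. \<forall>j\<in>{1..p}. True)"
        by (intro runs_within_for_each[where n = 1]) (simp_all add: less_op_def runs_within_charge)
      show "runs_within (for_each {1..p} (\<lambda>j. if negative j then sub_op 0 (x j) else ret (x j))) p
          (\<lambda>t. \<forall>j\<in>{1..p}. True)" for negative x
        by (intro runs_within_for_each[where n = 1])
          (simp_all add: sub_op_def runs_within_charge runs_within_ret)
      then show "runs_within (for_each {1..p} (\<lambda>j. if negative j then sub_op 0 (x j) else ret (x j))) p
          (\<lambda>_. True)" for negative x
        by (rule runs_within_mono) simp_all
      show "runs_within (for_each {1..p} (\<lambda>j. sub_op (x j) (y j))) p (\<lambda>t. \<forall>j\<in>{1..p}. True)" for x y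
        by (intro runs_within_for_each[where n = 1]) (simp_all add: sub_op_def runs_within_charge)
      show "runs_within (canonical_graph p G \<eta> lam v) (card G + (?M + (?M + 2)\<^sup>2))
          (\<lambda>N. canonical_part \<eta> lam N \<and> card (verts N) = ?M)" for v
        using G lam by (intro runs_within_canonical_graph) (auto intro: less_imp_le)
      show "runs_within (computeFlow MF PR v \<eta> lam N) ((2 * ?M - 1) * poly B ?M) (\<lambda>_. True)"
        if N: "canonical_part \<eta> lam N \<and> card (verts N) = ?M" for v N
      proof -
        have "runs_within (computeFlow MF PR v \<eta> lam N)
          ((2 * card (verts N) - 1) *
            (poly R ?M + poly S ?M + 7 * ?M + 3 + 6 * (?M + 2)\<^sup>2)) (\<lambda>_. True)"
        proof (rule runs_within_computeFlow)
          show "runs_within (MF N) (poly R ?M) (is_max_flow N)"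
            if "wf_network N" "bounded_network N" "card (verts N) \<le> ?M" "card (arcs N) \<le> (?M + 2)\<^sup>2"
            for N
            using PM[OF that(1,2)] R[OF that(3,4)] by (rule runs_within_mono)
          show "runs_within (PR J v b) (poly S ?M) (is_projection J v b)"
            if "finite J" "card J \<le> ?M" "0 \<le> b" for J b
            using S[OF that(1,3)] poly_nat_mono[OF that(2)] by (rule runs_within_mono)
          \<comment> \<open>The vertex count is \<open>p + card G\<close>, which is positive because
            \<open>p \<ge> 1\<close>.\<close>
          show "verts N \<noteq> {}"
            using N p by auto
        qed (use N lam in auto)
        then show ?thesis
          using N by (simp add: B)
      qed
    qed
    moreover have "p + (p + ((card G + (?M + (?M + 2)\<^sup>2)) + ((2 * ?M - 1) * poly B ?M + (p + p))))
        \<le> poly T ?M"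
    proof -
      \<comment> \<open>With variables in place of the square and the products, the comparison is
        linear.\<close>
      have regroup: "p + (p + ((c + (p + c + s)) + (x + (p + p)))) \<le> 6 * (p + c) + s + y"
        if "x \<le> y" for c s x y :: nat
        using that by simp
      show ?thesis
        unfolding T by (rule regroup) (rule mult_right_mono, simp_all)
    qed
    ultimately show ?thesis
      unfolding Q[symmetric] by (rule runs_within_mono)
  qed
  then show ?thesis
    unfolding runs_within_def by (intro exI[of _ Q] allI impI, elim conjE) simp
qed

end
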